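(* For $\boldsymbol\theta=(\delta,\alpha,p)$ with $\delta>0$, $\alpha\in(0,1]$ and $p\in(0,1)$, let $f_{\boldsymbol\theta}$ be the generalized spectrum of the causal integer-valued MA(1) process $Z_t=p\circ\epsilon_{t-1}+\epsilon_t$, $t\in\mathbb Z$, where $\{\epsilon_t\}$ is i.i.d. discrete stable with scale parameter $\delta$ and exponent $\alpha$. Then $\boldsymbol\theta$ is identifiable from the generalized spectrum: if $\boldsymbol\theta$ and $\boldsymbol\theta'$ are two such parameters with $f_{\boldsymbol\theta}(\lambda;u,v)=f_{\boldsymbol\theta'}(\lambda;u,v)$ for all $\lambda\in[0,2\pi]$ and $(u,v)\in[-\pi,\pi]^2$, then $\boldsymbol\theta=\boldsymbol\theta'$.
   Context: The generalized spectrum of a strictly stationary process $\{Z_t\}$ is $$f(\lambda;u,v)=\frac1{2\pi}\sum_{\ell=-\infty}^\infty\bigl\{{\rm E}(e^{iuZ_{t+\ell}+ivZ_t})-{\rm E}(e^{iuZ_{t+\ell}}){\rm E}(e^{ivZ_t})\bigr\}e^{-i\ell\lambda},\quad\lambda\in\mathbb R,\ (u,v)\in\mathbb R^2.$$ A nonnegative integer-valued random variable $W$ is discrete stable with scale parameter $\delta>0$ and exponent $\alpha\in(0,1]$ if ${\rm E}(x^W)=\exp\{-\delta(1-x)^\alpha\}$ for complex $x$ with $|x|\le1$ (principal branch). Binomial thinning: for a nonnegative integer-valued process $\{X_t\}$, $p\circ X_t=\sum_{i=1}^{X_t}Y_{i,t}$ (equal to $0$ if $X_t=0$), where the $Y_{i,t}$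 are i.i.d. (in $i$ and $t$) Bernoulli variables with parameter $p$; in this model the array $\{Y_{i,t}\}$ is independent of $\{\epsilon_t\}$. *)

theory Defs
  imports "HOL-Probability.Probability"
begin

text \<open>
  The process is meant to be strictly stationary, so the covariances do not depend on the
  reference time \<open>t\<close>, which is taken to be \<open>0\<close>. The two-sided series is the
  unordered sum over the integers.
\<close>

definition gen_autocov :: "'a measure \<Rightarrow> (int \<Rightarrow> 'a \<Rightarrow> real) \<Rightarrow> int \<Rightarrow> real \<Rightarrow> real \<Rightarrow> complex" where
  "gen_autocov M Z l u v =
     (\<integral>\<omega>. exp (\<i> * of_real (u * Z l \<omega>) + \<i> * of_real (v * Z 0 \<omega>)) \<partial>M)
     - (\<integral>\<omega>. exp (\<i> * of_real (u * Z l \<omega>)) \<partial>M) * (\<integral>\<omega>. exp (\<i> * of_real (v * Z 0 \<omega>)) \<partial>M)"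

definition gen_spectrum :: "'a measure \<Rightarrow> (int \<Rightarrow> 'a \<Rightarrow> real) \<Rightarrow> real \<Rightarrow> real \<Rightarrow> real \<Rightarrow> complex" where
  "gen_spectrum M Z lam u v =
     1 / (2 * of_real pi) *
     (\<Sum>\<^sub>\<infinity>l\<in>UNIV. gen_autocov M Z l u v * exp (- \<i> * of_int l * of_real lam))"

text \<open>
  Complex \<open>powr\<close> is the principal branch, with \<open>0 powr a = 0\<close> giving the value \<open>1\<close> at \<open>x = 1\<close>.
\<close>

definition discrete_stable :: "'a measure \<Rightarrow> ('a \<Rightarrow> nat) \<Rightarrow> real \<Rightarrow> real \<Rightarrow> bool" where
  "discrete_stable M W \<delta> \<alpha> \<longleftrightarrow>
     \<delta> > 0 \<and> 0 < \<alpha> \<and> \<alpha> \<le> 1 \<and> W \<in> measurable M (count_space UNIV) \<and>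
     (\<forall>x::complex. norm x \<le> 1 \<longrightarrow>
        (\<integral>\<omega>. x ^ W \<omega> \<partial>M) = exp (- of_real \<delta> * (1 - x) powr of_real \<alpha>))"

definition thinning :: "(nat \<Rightarrow> int \<Rightarrow> 'a \<Rightarrow> nat) \<Rightarrow> (int \<Rightarrow> 'a \<Rightarrow> nat) \<Rightarrow> int \<Rightarrow> 'a \<Rightarrow> nat" where
  "thinning Y X t \<omega> = (\<Sum>i=1..X t \<omega>. Y i t \<omega>)"

definition int_ma1 :: "(nat \<Rightarrow> int \<Rightarrow> 'a \<Rightarrow> nat) \<Rightarrow> (int \<Rightarrow> 'a \<Rightarrow> nat) \<Rightarrow> int \<Rightarrow> 'a \<Rightarrow> nat" where
  "int_ma1 Y eps t \<omega> = thinning Y eps (t - 1) \<omega> + eps t \<omega>"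

text \<open>
  The generating function determines the law, so \<open>eps_stable\<close> makes the innovations
  identically distributed. The last assumption is independence of the \<open>\<sigma>\<close>-algebras generated by
  the whole innovation process and the whole array; \<open>indep_var\<close> does not apply because the two
  random elements have different types.
\<close>

locale stable_ma1 = prob_space M for M :: "'a measure" +
  fixes \<delta> \<alpha> p :: real
    and eps :: "int \<Rightarrow> 'a \<Rightarrow> nat"
    and Y :: "nat \<Rightarrow> int \<Rightarrow> 'a \<Rightarrow> nat"
  assumes eps_stable: "\<And>t. discrete_stable M (eps t) \<delta> \<alpha>"
    and eps_indep: "indep_vars (\<lambda>_. count_space UNIV) eps UNIV"
    and Y_bernoulli: "\<And>i t. i \<ge> 1 \<Longrightarrow>
          distr M (count_space UNIV) (Y i t) = measure_pmf (map_pmf of_bool (bernoulli_pmf p))"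
    and Y_indep: "indep_vars (\<lambda>_. count_space UNIV) (\<lambda>(i, t). Y i t) ({1..} \<times> UNIV)"
    and Y_eps_indep: "indep_set
          (sets (vimage_algebra (space M) (\<lambda>\<omega> t. eps t \<omega>)
             (PiM UNIV (\<lambda>_. count_space UNIV))))
          (sets (vimage_algebra (space M) (\<lambda>\<omega>. \<lambda>(i, t)\<in>{1..} \<times> UNIV. Y i t \<omega>)
             (PiM ({1..} \<times> UNIV) (\<lambda>_. count_space UNIV))))"

end

theory Submission
  imports Defs
begin

text \<open>
  The process is \<open>1\<close>-dependent: the value at time \<open>t\<close> is a function of the innovations at
  \<open>t - 1\<close> and \<open>t\<close> and of the Bernoulli variables at \<open>t - 1\<close>. So only the generalized
  autocovariances at lags \<open>-1\<close>, \<open>0\<close>, \<open>1\<close> survive, the spectrum is a trigonometric polynomial of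
  degree one in \<open>\<lambda>\<close>, and its values at \<open>0\<close>, \<open>\<pi>/2\<close>, \<open>\<pi>\<close> give back these autocovariances. Three
  numbers read off from them determine the parameters.

  Let \<open>G x = exp (- \<delta> (1 - x)\<^sup>\<alpha>)\<close> be the generating function of an innovation. Given the
  innovation, thinning is binomial, so the pair of the thinned and the unthinned innovation has
  generating function \<open>E (a\<^sup>T b\<^sup>\<epsilon>) = G (b (1 - p + p a))\<close> (\<open>block_pgf\<close>). Such pairs are independent for
  different times (\<open>indep_blocks\<close>), and every autocovariance is a sum of products of values of this
  function. In particular the marginal law is again discrete stable, with the same exponent and
  with scale \<open>C = \<delta> (1 + p\<^sup>\<alpha>)\<close>.

  At lag \<open>0\<close> and frequencies \<open>(u, -u)\<close> the autocovariance is one minus the squared modulus of the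
  marginal characteristic function. The choices \<open>u = \<pi>\<close> and \<open>u = \<pi>/3\<close>, where \<open>1 - e\<^sup>i\<^sup>u\<close> is \<open>2\<close> and
  \<open>e\<^sup>-\<^sup>i\<^sup>\<pi>\<^sup>/\<^sup>3\<close>, reveal \<open>C 2\<^sup>\<alpha>\<close> and \<open>C cos (\<alpha> \<pi>/3)\<close>. The quotient of these is strictly increasing in
  \<open>\<alpha>\<close>, so \<open>\<alpha>\<close> and \<open>C\<close> are known. At lag \<open>1\<close> and frequencies \<open>(\<pi>, \<pi>)\<close> the only unknown is
  \<open>G (-(1 - 2 p))\<close>, which gives \<open>\<delta> (2 (1 - p))\<^sup>\<alpha>\<close> and hence \<open>\<delta> (1 - p)\<^sup>\<alpha>\<close>. Since
  \<open>(1 + p\<^sup>\<alpha>) / (1 - p)\<^sup>\<alpha>\<close> is strictly increasing in \<open>p\<close>, this yields \<open>p\<close> and then \<open>\<delta>\<close>.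
\<close>

section \<open>Joint independence of innovations and thinning variables\<close>

text \<open>
  Independence is a statement about finitely many coordinates. A finite intersection of events
  from the combined family splits into a cylinder of the first family and one of the second. The
  cylinders are independent of each other by the hypothesis on the generated \<open>\<sigma>\<close>-algebras, and
  each of them factorizes on its own.
\<close>

lemma (in prob_space) indep_vars_Plus:
  fixes X :: "'i \<Rightarrow> 'a \<Rightarrow> 'c" and X' :: "'j \<Rightarrow> 'a \<Rightarrow> 'c"
  assumes X: "indep_vars N X I" and X': "indep_vars N' X' J"
    and indep: "indep_set
      (sets (vimage_algebra (space M) (\<lambda>\<omega>. \<lambda>i\<in>I. X i \<omega>) (PiM I N)))
      (sets (vimage_algebra (space M) (\<lambda>\<omega>. \<lambda>j\<in>J. X' j \<omega>) (PiM J N')))"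
  shows "indep_vars (case_sum N N') (case_sum X X') (I <+> J)"
proof -
  have cylinder: "(\<Inter>i\<in>K. A i) \<inter> space M \<in> sets (vimage_algebra (space M) (\<lambda>\<omega>. \<lambda>i\<in>L. V i \<omega>) (PiM L Q))"
    and prob_cylinder: "prob ((\<Inter>i\<in>K. A i) \<inter> space M) = (\<Prod>i\<in>K. prob (A i))"
    if V: "indep_vars Q V L" and K: "finite K" "K \<subseteq> L"
      and A: "\<forall>i\<in>K. A i \<in> {V i -` B \<inter> space M | B. B \<in> sets (Q i)}"
    for V :: "'k \<Rightarrow> 'a \<Rightarrow> 'c" and Q L K A
  proof -
    let ?G = "vimage_algebra (space M) (\<lambda>\<omega>. \<lambda>i\<in>L. V i \<omega>) (PiM L Q)"
    have rv: "V i \<in> measurable M (Q i)" if "i \<in> L" for i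
      using V that by (auto simp: indep_vars_def)
    have "(\<lambda>\<omega>. \<lambda>i\<in>L. V i \<omega>) \<in> space M \<rightarrow> space (PiM L Q)"
      by (auto simp: space_PiM intro!: measurable_space[OF rv])
    then have G: "(\<lambda>\<omega>. \<lambda>i\<in>L. V i \<omega>) \<in> measurable ?G (PiM L Q)"
      by (rule measurable_vimage_algebra1)
    have VG: "V i \<in> measurable ?G (Q i)" if "i \<in> L" for i
      using measurable_compose[OF G measurable_component_singleton[OF that]] that by simp
    have AG: "A i \<in> sets ?G" if i: "i \<in> K" for i
    proof -
      obtain B where B: "A i = V i -` B \<inter> space M" "B \<in> sets (Q i)"
        using bspec[OF A i] unfolding mem_Collect_eq by (elim exE conjE)
      have "i \<in> L" using K i by blast
      from measurable_sets[OF VG[OF this] B(2)] show ?thesis by (simp add: B(1))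
    qed
    show "(\<Inter>i\<in>K. A i) \<inter> space M \<in> sets ?G"
    proof (cases "K = {}")
      case True
      then show ?thesis by (simp add: sets_vimage_algebra_space)
    next
      case False
      then have "(\<Inter>i\<in>K. A i) \<in> sets ?G"
        using AG K by (intro sets.finite_INT) auto
      then show ?thesis
        using sets_vimage_algebra_space by (rule sets.Int)
    qed
    show "prob ((\<Inter>i\<in>K. A i) \<inter> space M) = (\<Prod>i\<in>K. prob (A i))"
    proof (cases "K = {}")
      case True
      then show ?thesis by (simp add: prob_space)
    next
      case False
      have "A i \<subseteq> space M" if "i \<in> K" for i
        using bspec[OF A that] by fast
      then have "(\<Inter>i\<in>K. A i) \<inter> space M = (\<Inter>i\<in>K. A i)"
        using False by fast
      then show ?thesis
        using V K A False unfolding indep_vars_def2 by (auto intro!: indep_setsD)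
    qed
  qed
  show ?thesis
    unfolding indep_vars_def2
  proof (intro conjI indep_setsI)
    show "\<forall>i\<in>I <+> J. random_variable (case_sum N N' i) (case_sum X X' i)"
      using X X' by (auto simp: indep_vars_def)
    then show "{case_sum X X' i -` A \<inter> space M |A. A \<in> sets (case_sum N N' i)} \<subseteq> events"
      if "i \<in> I <+> J" for i
      using measurable_sets[of "case_sum X X' i" M "case_sum N N' i"] that by blast
  next
    fix A K
    assume K: "K \<noteq> {}" "K \<subseteq> I <+> J" "finite K"
      and A: "\<forall>j\<in>K. A j \<in> {case_sum X X' j -` B \<inter> space M |B. B \<in> sets (case_sum N N' j)}"
    let ?K1 = "Inl -` K" and ?K2 = "Inr -` K"
    have K_eq: "K = ?K1 <+> ?K2"
      by (auto simp: Plus_def vimage_def image_def) (metis sumE)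
    have fin: "finite ?K1" "finite ?K2"
      using K by (auto intro!: finite_vimageI)
    have sub: "?K1 \<subseteq> I" "?K2 \<subseteq> J" using K by auto
    have A1: "\<forall>i\<in>?K1. A (Inl i) \<in> {X i -` B \<inter> space M |B. B \<in> sets (N i)}"
      using A by force
    have A2: "\<forall>i\<in>?K2. A (Inr i) \<in> {X' i -` B \<inter> space M |B. B \<in> sets (N' i)}"
      using A by force
    have "(\<Inter>j\<in>K. A j) = ((\<Inter>i\<in>?K1. A (Inl i)) \<inter> space M) \<inter> ((\<Inter>i\<in>?K2. A (Inr i)) \<inter> space M)"
      (is "?L = ?R")
    proof
      have "A j \<subseteq> space M" if "j \<in> K" for j
        using bspec[OF A that] by fast
      then show "?L \<subseteq> ?R" using K(1) by fast
      show "?R \<subseteq> ?L" by (subst (3) K_eq) auto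
    qed
    then have "prob (\<Inter>j\<in>K. A j) = (\<Prod>i\<in>?K1. prob (A (Inl i))) * (\<Prod>i\<in>?K2. prob (A (Inr i)))"
      using indep_setD[OF indep cylinder[OF X fin(1) sub(1) A1] cylinder[OF X' fin(2) sub(2) A2]]
      by (simp add: prob_cylinder[OF X fin(1) sub(1) A1] prob_cylinder[OF X' fin(2) sub(2) A2])
    also have "\<dots> = (\<Prod>j\<in>K. prob (A j))"
      by (subst (3) K_eq) (simp add: prod.Plus fin)
    finally show "prob (\<Inter>j\<in>K. A j) = (\<Prod>j\<in>K. prob (A j))" .
  qed
qed

context stable_ma1
begin

lemma indep_sources:
  "indep_vars (\<lambda>_. count_space UNIV) (case_sum eps (\<lambda>(i, t). Y i t)) (UNIV <+> ({1..} \<times> UNIV))"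
proof -
  have "indep_vars (case_sum (\<lambda>_. count_space UNIV) (\<lambda>_. count_space UNIV))
     (case_sum eps (\<lambda>(i, t). Y i t)) (UNIV <+> ({1..} \<times> UNIV))"
    using Y_eps_indep
    by (intro indep_vars_Plus eps_indep Y_indep) (simp add: restrict_UNIV case_prod_beta')
  moreover have "case_sum (\<lambda>_. count_space UNIV) (\<lambda>_. count_space UNIV) = (\<lambda>_. count_space (UNIV :: nat set))"
    by (auto split: sum.split)
  ultimately show ?thesis by simp
qed

lemma eps_measurable [measurable]: "eps t \<in> measurable M (count_space UNIV)"
  using eps_stable[of t] by (simp add: discrete_stable_def)

lemma Y_measurable: "i \<ge> 1 \<Longrightarrow> Y i t \<in> measurable M (count_space UNIV)"
  using Y_indep by (auto simp: indep_vars_def)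

text \<open>
  The block of time \<open>t\<close> consists of the innovation \<open>eps t\<close> and of all \<open>Y i t\<close>. The thinned and the
  unthinned innovation of time \<open>t\<close> both depend on that block only, and the blocks are disjoint.
\<close>

lemma indep_blocks:
  fixes a b :: "int \<Rightarrow> complex"
  shows "indep_vars (\<lambda>_. borel) (\<lambda>t \<omega>. a t ^ thinning Y eps t \<omega> * b t ^ eps t \<omega>) UNIV"
proof -
  define K :: "int \<Rightarrow> (int + nat \<times> int) set" where "K t = insert (Inl t) (Inr ` ({1..} \<times> {t}))" for t
  define g :: "int \<Rightarrow> ((int + nat \<times> int) \<Rightarrow> nat) \<Rightarrow> complex" where
    "g t w = a t ^ (\<Sum>i=1..w (Inl t). w (Inr (i, t))) * b t ^ w (Inl t)" for t w
  have g [measurable]: "g t \<in> borel_measurable (PiM (K t) (\<lambda>_. count_space UNIV))" for t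
  proof -
    have [measurable]: "(\<lambda>w. w j) \<in> measurable (PiM (K t) (\<lambda>_. count_space (UNIV :: nat set))) (count_space UNIV)"
      if "j \<in> K t" for j
      using that by (rule measurable_component_singleton)
    have "(\<lambda>w. a t ^ (\<Sum>i=1..n. w (Inr (i, t))) * b t ^ n) \<in> borel_measurable (PiM (K t) (\<lambda>_. count_space UNIV))" for n :: nat
      by measurable (auto simp: K_def)
    then show ?thesis
      unfolding g_def
      by (rule measurable_compose_countable[where g = "\<lambda>w. w (Inl t)"]) (auto simp: K_def)
  qed
  have "indep_vars (\<lambda>t. PiM (K t) (\<lambda>_. count_space UNIV))
      (\<lambda>t \<omega>. restrict (\<lambda>j. case_sum eps (\<lambda>(i, t). Y i t) j \<omega>) (K t)) UNIV"
    by (rule indep_vars_restrict[OF indep_sources]) (auto simp: K_def disjoint_family_on_def)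
  from indep_vars_compose2[OF this, of g "\<lambda>_. borel"]
  have "indep_vars (\<lambda>_. borel) (\<lambda>t \<omega>. g t (restrict (\<lambda>j. case_sum eps (\<lambda>(i, t). Y i t) j \<omega>) (K t))) UNIV"
    using g by blast
  also have "(\<lambda>t \<omega>. g t (restrict (\<lambda>j. case_sum eps (\<lambda>(i, t). Y i t) j \<omega>) (K t)))
      = (\<lambda>t \<omega>. a t ^ thinning Y eps t \<omega> * b t ^ eps t \<omega>)"
    by (auto simp: g_def K_def thinning_def fun_eq_iff intro!: sum.cong arg_cong2[where f = "(*)"] arg_cong2[where f="(^)"])
  finally show ?thesis .
qed

section \<open>Generating function of an innovation and its thinning\<close>

lemma Y_pgf:
  fixes a :: complex
  assumes "i \<ge> 1" "0 \<le> p" "p \<le> 1"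
  shows "(\<integral>\<omega>. a ^ Y i t \<omega> \<partial>M) = 1 - of_real p + of_real p * a"
proof -
  have "(\<integral>\<omega>. a ^ Y i t \<omega> \<partial>M) = (\<integral>k. a ^ k \<partial>distr M (count_space UNIV) (Y i t))"
    using Y_measurable[OF assms(1)] by (simp add: integral_distr)
  also have "\<dots> = 1 - of_real p + of_real p * a"
    using assms(2,3)
    by (simp add: Y_bernoulli[OF assms(1)] integral_measure_pmf[of UNIV] UNIV_bool scaleR_conv_of_real)
  finally show ?thesis .
qed

text \<open>
  On the event \<open>eps t = n\<close> the thinning is a sum of \<open>n\<close> variables, and the indicator of this event
  is independent of them.
\<close>

lemma block_pgf_on_level:
  fixes a :: complex
  assumes a: "norm a \<le> 1" and p: "0 \<le> p" "p \<le> 1"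
  shows "(\<integral>\<omega>. of_bool (eps t \<omega> = n) * a ^ (\<Sum>i=1..n. Y i t \<omega>) \<partial>M)
    = (\<integral>\<omega>. of_bool (eps t \<omega> = n) \<partial>M) * (1 - of_real p + of_real p * a) ^ n"
proof -
  define V where "V = case_sum eps (\<lambda>(i, t). Y i t)"
  define g :: "int + nat \<times> int \<Rightarrow> nat \<Rightarrow> complex" where
    "g = case_sum (\<lambda>_ m. of_bool (m = n)) (\<lambda>_ m. a ^ m)"
  define K where "K = insert (Inl t) ((\<lambda>i. Inr (i, t)) ` {1..n})"
  have prod_K: "(\<Prod>j\<in>K. h j) = h (Inl t) * (\<Prod>i=1..n. h (Inr (i, t)))" for h :: "_ \<Rightarrow> complex"
    by (simp add: K_def prod.reindex inj_on_def image_iff)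
  have V: "indep_vars (\<lambda>_. count_space UNIV) V K"
    unfolding V_def by (rule indep_vars_subset[OF indep_sources]) (auto simp: K_def)
  have ind: "indep_vars (\<lambda>_. borel) (\<lambda>j \<omega>. g j (V j \<omega>)) K"
    by (rule indep_vars_compose2[OF V]) auto
  have int: "integrable M (\<lambda>\<omega>. g j (V j \<omega>))" if "j \<in> K" for j
  proof (rule integrable_const_bound[where B = 1])
    show "(\<lambda>\<omega>. g j (V j \<omega>)) \<in> borel_measurable M"
      using ind that by (auto simp: indep_vars_def)
    show "AE \<omega> in M. norm (g j (V j \<omega>)) \<le> 1"
      using a by (auto simp: g_def norm_power power_le_one split: sum.split)
  qed
  have "(\<integral>\<omega>. (\<Prod>j\<in>K. g j (V j \<omega>)) \<partial>M) = (\<Prod>j\<in>K. \<integral>\<omega>. g j (V j \<omega>) \<partial>M)"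
    by (rule indep_vars_lebesgue_integral[OF _ ind int]) (auto simp: K_def)
  then show ?thesis
    by (simp add: prod_K) (simp add: g_def V_def power_sum Y_pgf p)
qed


lemma thinning_weight_le_1:
  fixes a :: complex
  assumes "norm a \<le> 1" "0 \<le> p" "p \<le> 1"
  shows "norm (1 - of_real p + of_real p * a) \<le> 1"
proof -
  have "norm (1 - of_real p + of_real p * a) \<le> norm (of_real (1 - p) :: complex) + norm (of_real p * a)"
    by (metis norm_triangle_ineq of_real_1 of_real_diff)
  also have "\<dots> \<le> (1 - p) + p * 1"
    using assms mult_left_mono[of "norm a" 1 p] by (simp add: norm_mult del: of_real_diff)
  finally show ?thesis by simp
qed

text \<open>
  Given the innovation, thinning has a binomial law, so averaging over the Bernoulli variables
  turns each factor \<open>a\<^sup>Y\<close> into \<open>1 - p + p a\<close>. The sum over the possible values of the innovation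
  is cut off at \<open>N\<close> so that it can be exchanged with the integral, and dominated convergence
  removes the cutoff.
\<close>

lemma block_expectation:
  fixes a b :: complex
  assumes a: "norm a \<le> 1" and b: "norm b \<le> 1" and p: "0 \<le> p" "p \<le> 1"
  shows "(\<integral>\<omega>. a ^ thinning Y eps t \<omega> * b ^ eps t \<omega> \<partial>M)
    = (\<integral>\<omega>. (b * (1 - of_real p + of_real p * a)) ^ eps t \<omega> \<partial>M)"
proof -
  define q where "q = 1 - of_real p + of_real p * a"
  have q: "norm q \<le> 1"
    unfolding q_def using a p by (rule thinning_weight_le_1)
  have truncate: "(\<lambda>N. \<integral>\<omega>. of_bool (eps t \<omega> < N) * f \<omega> \<partial>M) \<longlonglongrightarrow> (\<integral>\<omega>. f \<omega> \<partial>M)"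
    if [measurable]: "f \<in> borel_measurable M" and f: "\<And>\<omega>. norm (f \<omega>) \<le> 1" for f :: "'a \<Rightarrow> complex"
  proof (rule integral_dominated_convergence[where w = "\<lambda>_. 1"])
    show "AE \<omega> in M. (\<lambda>N. of_bool (eps t \<omega> < N) * f \<omega>) \<longlonglongrightarrow> f \<omega>"
    proof (rule AE_I2)
      fix \<omega>
      have "\<forall>\<^sub>F N in sequentially. of_bool (eps t \<omega> < N) * f \<omega> = f \<omega>"
        using eventually_gt_at_top[of "eps t \<omega>"] by eventually_elim simp
      then show "(\<lambda>N. of_bool (eps t \<omega> < N) * f \<omega>) \<longlonglongrightarrow> f \<omega>"
        by (rule tendsto_eventually)
    qed
    show "AE \<omega> in M. norm (of_bool (eps t \<omega> < N) * f \<omega>) \<le> 1" for N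
      using f by (simp add: norm_mult)
  qed simp_all
  have levels: "(\<integral>\<omega>. of_bool (eps t \<omega> < N) * f (eps t \<omega>) \<omega> \<partial>M) = (\<Sum>n<N. \<integral>\<omega>. of_bool (eps t \<omega> = n) * f n \<omega> \<partial>M)"
    if [measurable]: "\<And>n. f n \<in> borel_measurable M" and f: "\<And>n \<omega>. norm (f n \<omega>) \<le> 1"
    for f :: "nat \<Rightarrow> 'a \<Rightarrow> complex" and N
  proof -
    have "of_bool (eps t \<omega> < N) * f (eps t \<omega>) \<omega> = (\<Sum>n<N. of_bool (eps t \<omega> = n) * f n \<omega>)" for \<omega>
    proof -
      have "(\<Sum>n<N. of_bool (eps t \<omega> = n) * f n \<omega>) = (\<Sum>n<N. if n = eps t \<omega> then f n \<omega> else 0)"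
        by (intro sum.cong) auto
      then show ?thesis by simp
    qed
    moreover have "integrable M (\<lambda>\<omega>. of_bool (eps t \<omega> = n) * f n \<omega>)" for n
      by (rule integrable_const_bound[where B = 1]) (auto simp: f norm_mult)
    ultimately show ?thesis
      by (simp only:) (rule Bochner_Integration.integral_sum)
  qed
  have meas: "(\<lambda>\<omega>. a ^ thinning Y eps t \<omega> * b ^ eps t \<omega>) \<in> borel_measurable M"
    using indep_blocks[of "\<lambda>_. a" "\<lambda>_. b"] by (auto simp: indep_vars_def)
  have measY: "(\<lambda>\<omega>. b ^ n * a ^ (\<Sum>i=1..n. Y i t \<omega>)) \<in> borel_measurable M" for n
    using Y_measurable by measurable
  have le1: "norm (b ^ n * a ^ m) \<le> 1" "norm ((b * q) ^ n) \<le> 1" for n m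
    using a b q by (simp_all add: norm_mult norm_power power_le_one mult_le_one)
  have "(\<integral>\<omega>. of_bool (eps t \<omega> < N) * (a ^ thinning Y eps t \<omega> * b ^ eps t \<omega>) \<partial>M)
      = (\<integral>\<omega>. of_bool (eps t \<omega> < N) * (b * q) ^ eps t \<omega> \<partial>M)" for N
  proof -
    have "(\<integral>\<omega>. of_bool (eps t \<omega> < N) * (a ^ thinning Y eps t \<omega> * b ^ eps t \<omega>) \<partial>M)
        = (\<Sum>n<N. \<integral>\<omega>. of_bool (eps t \<omega> = n) * (b ^ n * a ^ (\<Sum>i=1..n. Y i t \<omega>)) \<partial>M)"
      using levels[of "\<lambda>n \<omega>. b ^ n * a ^ (\<Sum>i=1..n. Y i t \<omega>)" N] measY le1
      by (simp add: thinning_def mult.commute)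
    also have "\<dots> = (\<Sum>n<N. b ^ n * (\<integral>\<omega>. of_bool (eps t \<omega> = n) * a ^ (\<Sum>i=1..n. Y i t \<omega>) \<partial>M))"
      by (simp add: mult.left_commute)
    also have "\<dots> = (\<Sum>n<N. \<integral>\<omega>. of_bool (eps t \<omega> = n) * (b * q) ^ n \<partial>M)"
      by (simp only: block_pgf_on_level[OF a p]) (simp add: q_def power_mult_distrib mult_ac)
    also have "\<dots> = (\<integral>\<omega>. of_bool (eps t \<omega> < N) * (b * q) ^ eps t \<omega> \<partial>M)"
      using levels[of "\<lambda>n \<omega>. (b * q) ^ n" N] le1 by simp
    finally show ?thesis .
  qed
  moreover have "(\<lambda>N. \<integral>\<omega>. of_bool (eps t \<omega> < N) * (a ^ thinning Y eps t \<omega> * b ^ eps t \<omega>) \<partial>M)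
      \<longlonglongrightarrow> (\<integral>\<omega>. a ^ thinning Y eps t \<omega> * b ^ eps t \<omega> \<partial>M)"
    using le1(1) by (intro truncate meas) (metis mult.commute)
  moreover have "(\<lambda>N. \<integral>\<omega>. of_bool (eps t \<omega> < N) * (b * q) ^ eps t \<omega> \<partial>M)
      \<longlonglongrightarrow> (\<integral>\<omega>. (b * q) ^ eps t \<omega> \<partial>M)"
    by (intro truncate le1) simp
  ultimately show ?thesis
    unfolding q_def by (auto intro: LIMSEQ_unique)
qed

definition block_pgf :: "complex \<Rightarrow> complex \<Rightarrow> complex" where
  "block_pgf a b =
     exp (- of_real \<delta> * (1 - b * (1 - of_real p + of_real p * a)) powr of_real \<alpha>)"

lemma block_pgf:
  assumes a: "norm a \<le> 1" and b: "norm b \<le> 1" and p: "0 \<le> p" "p \<le> 1"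
  shows "(\<integral>\<omega>. a ^ thinning Y eps t \<omega> * b ^ eps t \<omega> \<partial>M) = block_pgf a b"
proof -
  have "norm (b * (1 - of_real p + of_real p * a)) \<le> 1"
    using b thinning_weight_le_1[OF a p] by (simp add: norm_mult mult_le_one)
  then show ?thesis
    using eps_stable[of t] by (simp add: block_expectation[OF a b p] discrete_stable_def block_pgf_def)
qed

lemma block_pgf_1_1 [simp]: "block_pgf 1 1 = 1"
  by (simp add: block_pgf_def)

section \<open>Generating functions of the moving average\<close>

text \<open>
  The product over the four times \<open>-1\<close>, \<open>0\<close>, \<open>l - 1\<close>, \<open>l\<close> collects what each block contributes to
  the two values of the process. When some of these times coincide, the index set shrinks
  and the arguments \<open>x\<close> and \<open>y\<close> meet inside one factor, so that one formula covers every lag.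
\<close>

lemma ma1_joint_pgf:
  fixes x y :: complex
  assumes x: "norm x \<le> 1" and y: "norm y \<le> 1" and p: "0 \<le> p" "p \<le> 1"
  shows "(\<integral>\<omega>. x ^ int_ma1 Y eps l \<omega> * y ^ int_ma1 Y eps 0 \<omega> \<partial>M)
    = (\<Prod>t\<in>{-1, 0, l - 1, l}. block_pgf
         ((if t = l - 1 then x else 1) * (if t = -1 then y else 1))
         ((if t = l then x else 1) * (if t = 0 then y else 1)))"
proof -
  define J where "J = {-1, 0, l - 1, l}"
  define a where "a t = (if t = l - 1 then x else 1) * (if t = -1 then y else 1)" for t
  define b where "b t = (if t = l then x else 1) * (if t = 0 then y else 1)" for t
  define W where "W t \<omega> = a t ^ thinning Y eps t \<omega> * b t ^ eps t \<omega>" for t \<omega>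
  have a: "norm (a t) \<le> 1" and b: "norm (b t) \<le> 1" for t
    using x y by (simp_all add: a_def b_def norm_mult mult_le_one)
  have J: "finite J" "-1 \<in> J" "0 \<in> J" "l - 1 \<in> J" "l \<in> J"
    by (simp_all add: J_def)
  have "x ^ int_ma1 Y eps l \<omega> * y ^ int_ma1 Y eps 0 \<omega> = (\<Prod>t\<in>J. W t \<omega>)" for \<omega>
  proof -
    have "(\<Prod>t\<in>J. W t \<omega>) =
        (\<Prod>t\<in>J. (if t = l - 1 then x ^ thinning Y eps t \<omega> else 1) *
          (if t = -1 then y ^ thinning Y eps t \<omega> else 1) *
          (if t = l then x ^ eps t \<omega> else 1) *
          (if t = 0 then y ^ eps t \<omega> else 1))"
      by (intro prod.cong) (auto simp: W_def a_def b_def power_mult_distrib)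
    also have "\<dots> = x ^ thinning Y eps (l - 1) \<omega> * y ^ thinning Y eps (-1) \<omega> * x ^ eps l \<omega> * y ^ eps 0 \<omega>"
      using J by (simp add: prod.distrib)
    finally show ?thesis
      by (simp add: int_ma1_def power_add mult_ac)
  qed
  moreover have ind: "indep_vars (\<lambda>_. borel) W J"
    unfolding W_def by (rule indep_vars_subset[OF indep_blocks]) simp
  moreover have "integrable M (W t)" if "t \<in> J" for t
  proof (rule integrable_const_bound[where B = 1])
    show "W t \<in> borel_measurable M"
      using ind that by (auto simp: indep_vars_def)
    show "AE \<omega> in M. norm (W t \<omega>) \<le> 1"
      using a b by (simp add: W_def norm_mult norm_power power_le_one mult_le_one)
  qed
  ultimately have "(\<integral>\<omega>. x ^ int_ma1 Y eps l \<omega> * y ^ int_ma1 Y eps 0 \<omega> \<partial>M) = (\<Prod>t\<in>J. \<integral>\<omega>. W t \<omega> \<partial>M)"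
    using indep_vars_lebesgue_integral[of J W] J(1) by simp
  then show ?thesis
    by (simp add: W_def block_pgf a b p) (simp add: a_def b_def J_def)
qed

lemma ma1_pgf:
  fixes x :: complex
  assumes x: "norm x \<le> 1" and p: "0 \<le> p" "p \<le> 1"
  shows "(\<integral>\<omega>. x ^ int_ma1 Y eps l \<omega> \<partial>M) = block_pgf x 1 * block_pgf 1 x"
proof -
  have "(\<integral>\<omega>. x ^ int_ma1 Y eps l \<omega> \<partial>M)
    = (\<Prod>t\<in>{-1, 0, l - 1, l}. block_pgf (if t = l - 1 then x else 1) (if t = l then x else 1))"
    using ma1_joint_pgf[of x 1 l] assms by simp
  also have "\<dots> = (\<Prod>t\<in>{l - 1, l}. block_pgf (if t = l - 1 then x else 1) (if t = l then x else 1))"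
    by (rule prod.mono_neutral_right) auto
  finally show ?thesis by simp
qed

text \<open>
  Thinning a discrete stable variable multiplies the scale by \<open>p\<^sup>\<alpha>\<close>, because
  \<open>1 - (1 - p + p x) = p (1 - x)\<close>; the scales of independent summands add up.
\<close>

lemma ma1_pgf_stable:
  fixes x :: complex
  assumes x: "norm x \<le> 1" and p: "0 \<le> p" "p \<le> 1"
  shows "(\<integral>\<omega>. x ^ int_ma1 Y eps l \<omega> \<partial>M)
    = exp (- of_real (\<delta> * (1 + p powr \<alpha>)) * (1 - x) powr of_real \<alpha>)"
proof -
  have "(1 - (1 - of_real p + of_real p * x)) = of_real p * (1 - x)"
    by (simp add: algebra_simps)
  then have "(1 - (1 - of_real p + of_real p * x)) powr of_real \<alpha>
      = of_real (p powr \<alpha>) * (1 - x) powr of_real \<alpha>"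
    using p by (simp add: powr_times_real_left powr_of_real)
  then have "block_pgf x 1 = exp (- of_real (\<delta> * p powr \<alpha>) * (1 - x) powr of_real \<alpha>)"
    by (simp add: block_pgf_def mult.assoc)
  moreover have "block_pgf 1 x = exp (- of_real \<delta> * (1 - x) powr of_real \<alpha>)"
    by (simp add: block_pgf_def)
  ultimately show ?thesis
    unfolding ma1_pgf[OF assms] by (simp add: algebra_simps flip: exp_add)
qed

section \<open>Autocovariances and spectrum\<close>

abbreviation "Z \<equiv> \<lambda>t \<omega>. real (int_ma1 Y eps t \<omega>)"

lemma gen_autocov_pgf:
  "gen_autocov M Z l u v =
     (\<integral>\<omega>. cis u ^ int_ma1 Y eps l \<omega> * cis v ^ int_ma1 Y eps 0 \<omega> \<partial>M)
     - (\<integral>\<omega>. cis u ^ int_ma1 Y eps l \<omega> \<partial>M) * (\<integral>\<omega>. cis v ^ int_ma1 Y eps 0 \<omega> \<partial>M)"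
proof -
  have "exp (\<i> * of_real (u * real n)) = cis u ^ n" for u n
    by (simp add: cis_conv_exp mult_ac flip: exp_of_nat_mult)
  then show ?thesis
    by (simp only: gen_autocov_def exp_add)
qed

text \<open>
  At these lags the times \<open>-1\<close>, \<open>0\<close>, \<open>l - 1\<close>, \<open>l\<close> are distinct, so the two values of the process
  use disjoint sets of blocks.
\<close>

lemma gen_autocov_eq_0:
  assumes l: "l \<notin> {-1, 0, 1}" and p: "0 \<le> p" "p \<le> 1"
  shows "gen_autocov M Z l u v = 0"
proof -
  have "l - 1 \<noteq> -1" "l - 1 \<noteq> 0" "l \<noteq> -1" "l \<noteq> 0" "l \<noteq> 1" using l by auto
  then show ?thesis
    by (simp add: gen_autocov_pgf ma1_joint_pgf ma1_pgf p)
qed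

lemma gen_spectrum_eq:
  assumes p: "0 \<le> p" "p \<le> 1"
  shows "gen_spectrum M Z lam u v = 1 / (2 * of_real pi) *
    (gen_autocov M Z 0 u v + gen_autocov M Z 1 u v * cis (- lam) + gen_autocov M Z (-1) u v * cis lam)"
proof -
  have "(\<Sum>\<^sub>\<infinity>l\<in>UNIV. gen_autocov M Z l u v * exp (- \<i> * of_int l * of_real lam))
      = (\<Sum>\<^sub>\<infinity>l\<in>{-1, 0, 1}. gen_autocov M Z l u v * exp (- \<i> * of_int l * of_real lam))"
    by (rule infsum_cong_neutral) (use gen_autocov_eq_0[OF _ p] in auto)
  then show ?thesis
    by (simp add: gen_spectrum_def cis_conv_exp algebra_simps)
qed

text \<open>
  The half sum of the spectrum at \<open>0\<close> and \<open>\<pi>\<close> isolates lag \<open>0\<close>, and the half difference isolates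
  the sum of the lags \<open>1\<close> and \<open>-1\<close>. The value at \<open>\<pi>/2\<close> separates these two lags.
\<close>

lemma gen_autocov_from_gen_spectrum:
  fixes u v :: real
  assumes p: "0 \<le> p" "p \<le> 1"
  defines "f \<equiv> \<lambda>lam. gen_spectrum M Z lam u v"
  shows "gen_autocov M Z 0 u v = of_real pi * (f 0 + f pi)"
    and "gen_autocov M Z 1 u v = of_real pi * ((f 0 - f pi) / 2 + \<i> * (f (pi / 2) - (f 0 + f pi) / 2))"
proof -
  define A B C where "A = gen_autocov M Z 0 u v" and "B = gen_autocov M Z 1 u v"
    and "C = gen_autocov M Z (-1) u v"
  have "cis (- (pi / 2)) = - \<i>" by (simp add: complex_eq_iff)
  then have f: "f 0 = 1 / (2 * of_real pi) * (A + B + C)" "f pi = 1 / (2 * of_real pi) * (A - B - C)"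
    "f (pi / 2) = 1 / (2 * of_real pi) * (A - \<i> * B + \<i> * C)"
    by (simp_all add: f_def gen_spectrum_eq[OF p] A_def B_def C_def cis_mult flip: cis_inverse)
  show "gen_autocov M Z 0 u v = of_real pi * (f 0 + f pi)"
    unfolding f A_def[symmetric] by (simp add: field_simps)
  show "gen_autocov M Z 1 u v = of_real pi * ((f 0 - f pi) / 2 + \<i> * (f (pi / 2) - (f 0 + f pi) / 2))"
    unfolding f B_def[symmetric] by (simp add: field_simps)
qed

lemma gen_autocov_0_antidiagonal:
  assumes p: "0 \<le> p" "p \<le> 1"
  shows "gen_autocov M Z 0 u (- u) = 1 - exp (- of_real (\<delta> * (1 + p powr \<alpha>)) *
    ((1 - cis u) powr of_real \<alpha> + (1 - cis (- u)) powr of_real \<alpha>))"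
proof -
  have "cis u ^ n * cis (- u) ^ n = 1" for n
    by (simp add: cis_mult flip: power_mult_distrib)
  then show ?thesis
    by (simp add: gen_autocov_pgf ma1_pgf_stable p prob_space algebra_simps flip: exp_add)
qed

lemma gen_autocov_0_pi:
  assumes p: "0 \<le> p" "p \<le> 1"
  shows "gen_autocov M Z 0 pi (- pi) = of_real (1 - exp (- 2 * (\<delta> * (1 + p powr \<alpha>) * 2 powr \<alpha>)))"
proof -
  have "(2 :: complex) powr of_real \<alpha> = of_real (2 powr \<alpha>)"
    using powr_of_real[of 2 \<alpha>] by simp
  then show ?thesis
    by (simp add: gen_autocov_0_antidiagonal p mult_ac flip: exp_of_real cis_inverse)
qed

text \<open>
  The angle \<open>\<pi>/3\<close> is convenient because \<open>1 - cis (\<pi>/3)\<close> has modulus one, so that its power is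
  a pure rotation.
\<close>

lemma gen_autocov_0_pi_third:
  assumes p: "0 \<le> p" "p \<le> 1"
  shows "gen_autocov M Z 0 (pi / 3) (- (pi / 3)) =
    of_real (1 - exp (- 2 * (\<delta> * (1 + p powr \<alpha>) * cos (\<alpha> * pi / 3))))"
proof -
  have \<alpha>: "0 < \<alpha>" "\<alpha> \<le> 1"
    using eps_stable[of 0] by (auto simp: discrete_stable_def)
  have cis_powr: "cis x powr of_real \<alpha> = cis (\<alpha> * x)" if "x \<in> {-pi<..pi}" for x
    using that by (simp add: powr_def Ln_cis cis_conv_exp mult_ac)
  have "1 - cis (pi / 3) = cis (- (pi / 3))" "1 - cis (- (pi / 3)) = cis (pi / 3)"
    by (simp_all add: complex_eq_iff cos_60 sin_60)
  then have "(1 - cis (pi / 3)) powr of_real \<alpha> + (1 - cis (- (pi / 3))) powr of_real \<alpha>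
      = cis (\<alpha> * - (pi / 3)) + cis (\<alpha> * (pi / 3))"
    using cis_powr[of "pi / 3"] cis_powr[of "- (pi / 3)"] pi_gt_zero by simp
  also have "\<dots> = of_real (2 * cos (\<alpha> * pi / 3))"
    by (simp add: complex_eq_iff)
  finally show ?thesis
    unfolding gen_autocov_0_antidiagonal[OF p] by (simp add: mult_ac flip: exp_of_real)
qed

text \<open>
  The block of time \<open>0\<close> is shared by the two values of the process and contributes \<open>block_pgf (-1) (-1)\<close>;
  the blocks of times \<open>-1\<close> and \<open>1\<close> together contribute the marginal generating function at \<open>-1\<close>.
\<close>

lemma gen_autocov_1_pi:
  assumes p: "0 \<le> p" "p \<le> 1"
  defines "C \<equiv> \<delta> * (1 + p powr \<alpha>) * 2 powr \<alpha>"
  shows "gen_autocov M Z 1 pi pi =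
    of_real (exp (- C) * (exp (- (\<delta> * (2 * (1 - p)) powr \<alpha>)) - exp (- C)))"
proof -
  have two: "(2 :: complex) powr of_real \<alpha> = of_real (2 powr \<alpha>)"
    using powr_of_real[of 2 \<alpha>] by simp
  have "(\<integral>\<omega>. (- 1) ^ int_ma1 Y eps l \<omega> \<partial>M) = (of_real (exp (- C)) :: complex)" for l
    using ma1_pgf_stable[of "-1" l] p by (simp add: two C_def flip: exp_of_real)
  moreover have "block_pgf (- 1) 1 * block_pgf 1 (- 1) = of_real (exp (- C))"
    using calculation[of 0] ma1_pgf[of "-1" 0] p by simp
  moreover have "block_pgf (- 1) (- 1) = of_real (exp (- (\<delta> * (2 * (1 - p)) powr \<alpha>)))"
  proof -
    have "1 - (- 1) * (1 - of_real p + of_real p * (- 1)) = (of_real (2 * (1 - p)) :: complex)"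
      by (simp add: algebra_simps)
    then show ?thesis
      using p powr_of_real[of "2 * (1 - p)" \<alpha>] by (simp add: block_pgf_def flip: exp_of_real)
  qed
  ultimately show ?thesis
    using p by (simp add: gen_autocov_pgf ma1_joint_pgf algebra_simps)
qed

end

section \<open>Identification of the parameters\<close>

text \<open>
  Two monotonicity arguments. A larger \<open>\<alpha>\<close> makes \<open>2\<^sup>\<alpha>\<close> larger and \<open>cos (\<alpha> \<pi>/3)\<close> smaller, and the
  common factor \<open>C = \<delta> (1 + p\<^sup>\<alpha>)\<close> cannot compensate both changes. Once \<open>\<alpha>\<close> is known, the same happens
  with \<open>1 + p\<^sup>\<alpha>\<close>, \<open>(1 - p)\<^sup>\<alpha>\<close> and the common factor \<open>\<delta>\<close>.
\<close>

lemma parameters_eqI: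
  fixes \<delta> \<alpha> p \<delta>' \<alpha>' p' :: real
  assumes \<delta>: "\<delta> > 0" "\<delta>' > 0" and \<alpha>: "\<alpha> \<in> {0<..1}" "\<alpha>' \<in> {0<..1}"
    and p: "p \<in> {0<..<1}" "p' \<in> {0<..<1}"
    and 1: "\<delta> * (1 + p powr \<alpha>) * 2 powr \<alpha> = \<delta>' * (1 + p' powr \<alpha>') * 2 powr \<alpha>'"
    and 2: "\<delta> * (1 + p powr \<alpha>) * cos (\<alpha> * pi / 3) = \<delta>' * (1 + p' powr \<alpha>') * cos (\<alpha>' * pi / 3)"
    and 3: "\<delta> * (2 * (1 - p)) powr \<alpha> = \<delta>' * (2 * (1 - p')) powr \<alpha>'"
  shows "(\<delta>, \<alpha>, p) = (\<delta>', \<alpha>', p')"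
proof -
  have exponent_separates: "C * 2 powr a \<noteq> C' * 2 powr a' \<or> C * cos (a * pi / 3) \<noteq> C' * cos (a' * pi / 3)"
    if "0 < C" "0 < C'" "0 < a" "a < a'" "a' \<le> 1" for C C' a a' :: real
  proof (rule ccontr, simp, elim conjE)
    assume eq: "C * 2 powr a = C' * 2 powr a'" "C * cos (a * pi / 3) = C' * cos (a' * pi / 3)"
    have le: "0 \<le> a * pi / 3" "a * pi / 3 < a' * pi / 3" "a' * pi / 3 \<le> pi"
      using that mult_right_mono[of a' 1 pi] by auto
    have "a' * pi / 3 < pi / 2"
      using that mult_right_mono[of a' 1 pi] pi_gt_zero by linarith
    then have "cos (a' * pi / 3) > 0"
      using le by (intro cos_gt_zero) linarith+
    moreover have "cos (a' * pi / 3) < cos (a * pi / 3)"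
      using le by (intro cos_monotone_0_pi) auto
    moreover have "2 powr a < (2 :: real) powr a'" using that by simp
    then have "C' * 2 powr a < C * 2 powr a"
      using that eq(1) by (simp add: mult_strict_left_mono)
    then have "C' < C" by simp
    ultimately have "C' * cos (a' * pi / 3) < C * cos (a * pi / 3)"
      using that by (intro mult_strict_mono) auto
    with eq(2) show False by simp
  qed
  have C: "0 < \<delta> * (1 + p powr \<alpha>)" "0 < \<delta>' * (1 + p' powr \<alpha>')"
    using \<delta> by (auto intro!: mult_pos_pos add_pos_nonneg)
  have \<alpha>_eq: "\<alpha> = \<alpha>'"
    using exponent_separates[OF C, of \<alpha> \<alpha>'] exponent_separates[OF C(2,1), of \<alpha>' \<alpha>] 1 2 \<alpha> by fastforce
  have probability_separates: False
    if "0 < d" "0 < d'" "0 < q" "q < q'" "q' < 1" "d * (1 + q powr \<alpha>) = d' * (1 + q' powr \<alpha>)"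
      "d * (1 - q) powr \<alpha> = d' * (1 - q') powr \<alpha>" for d d' q q' :: real
  proof -
    have "q powr \<alpha> < q' powr \<alpha>" "(1 - q') powr \<alpha> < (1 - q) powr \<alpha>"
      using that \<alpha> by (auto intro!: powr_less_mono2)
    then have "d' * (1 + q powr \<alpha>) < d * (1 + q powr \<alpha>)" "d * (1 - q) powr \<alpha> < d' * (1 - q) powr \<alpha>"
      using that by (simp_all add: mult_strict_left_mono)
    then have "d' < d" "d < d'"
      by (auto simp: mult_less_cancel_right add_pos_nonneg split: if_splits)
    then show False by simp
  qed
  have "\<delta> * (1 + p powr \<alpha>) = \<delta>' * (1 + p' powr \<alpha>)" "\<delta> * (1 - p) powr \<alpha> = \<delta>' * (1 - p') powr \<alpha>"
    using 1 3 unfolding \<alpha>_eq powr_mult by simp_all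
  moreover from this have p_eq: "p = p'"
    using probability_separates[of \<delta> \<delta>' p p'] probability_separates[of \<delta>' \<delta> p' p] \<delta> p by fastforce
  ultimately have "\<delta> = \<delta>'"
    using p by simp
  with \<alpha>_eq p_eq show ?thesis by simp
qed

theorem lemma6:
  fixes M :: "'a measure" and M' :: "'b measure"
    and \<delta> \<alpha> p \<delta>' \<alpha>' p' :: real
    and eps :: "int \<Rightarrow> 'a \<Rightarrow> nat" and eps' :: "int \<Rightarrow> 'b \<Rightarrow> nat"
    and Y :: "nat \<Rightarrow> int \<Rightarrow> 'a \<Rightarrow> nat" and Y' :: "nat \<Rightarrow> int \<Rightarrow> 'b \<Rightarrow> nat"
  assumes "\<delta> > 0" and "\<alpha> \<in> {0<..1}" and "p \<in> {0<..<1}"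
    and "\<delta>' > 0" and "\<alpha>' \<in> {0<..1}" and "p' \<in> {0<..<1}"
    and "stable_ma1 M \<delta> \<alpha> p eps Y"
    and "stable_ma1 M' \<delta>' \<alpha>' p' eps' Y'"
    and "\<And>lam u v. lam \<in> {0..2 * pi} \<Longrightarrow> u \<in> {-pi..pi} \<Longrightarrow> v \<in> {-pi..pi} \<Longrightarrow>
           gen_spectrum M (\<lambda>t \<omega>. real (int_ma1 Y eps t \<omega>)) lam u v
           = gen_spectrum M' (\<lambda>t \<omega>. real (int_ma1 Y' eps' t \<omega>)) lam u v"
  shows "(\<delta>, \<alpha>, p) = (\<delta>', \<alpha>', p')"
proof (rule parameters_eqI)
  interpret P: stable_ma1 M \<delta> \<alpha> p eps Y by fact
  interpret P': stable_ma1 M' \<delta>' \<alpha>' p' eps' Y' by fact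
  have p: "0 \<le> p" "p \<le> 1" and p': "0 \<le> p'" "p' \<le> 1"
    using assms(3,6) by auto
  have autocov: "gen_autocov M P.Z l u v = gen_autocov M' P'.Z l u v"
    if "l \<in> {0, 1}" "u \<in> {-pi..pi}" "v \<in> {-pi..pi}" for l u v
    using that assms(9)[of 0 u v] assms(9)[of pi u v] assms(9)[of "pi / 2" u v]
    by (auto simp: P.gen_autocov_from_gen_spectrum[OF p] P'.gen_autocov_from_gen_spectrum[OF p'])
  show 1: "\<delta> * (1 + p powr \<alpha>) * 2 powr \<alpha> = \<delta>' * (1 + p' powr \<alpha>') * 2 powr \<alpha>'"
    using autocov[of 0 pi "-pi"]
    unfolding P.gen_autocov_0_pi[OF p] P'.gen_autocov_0_pi[OF p'] of_real_eq_iff by simp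
  show "\<delta> * (1 + p powr \<alpha>) * cos (\<alpha> * pi / 3) = \<delta>' * (1 + p' powr \<alpha>') * cos (\<alpha>' * pi / 3)"
    using autocov[of 0 "pi / 3" "- (pi / 3)"] pi_gt_zero
    unfolding P.gen_autocov_0_pi_third[OF p] P'.gen_autocov_0_pi_third[OF p'] of_real_eq_iff by simp
  show "\<delta> * (2 * (1 - p)) powr \<alpha> = \<delta>' * (2 * (1 - p')) powr \<alpha>'"
    using autocov[of 1 pi pi]
    unfolding P.gen_autocov_1_pi[OF p] P'.gen_autocov_1_pi[OF p'] of_real_eq_iff 1 by simp
qed (use assms in auto)

end
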